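(* Let $f_0:\mathbb{N}\to[0,\infty)$ satisfy $m_\kappa\langle f_0\rangle<\infty$ for a fixed $\kappa>\max\{\delta,1,2-\alpha_1-\beta_1\}$, and let $f(t)$ be the solution of the discrete equation $\frac{\partial f}{\partial t}=O[f]$ with initial data $f_0$. Define $I:=\{i\in\mathbb{N}: f_0(i)>0\}$ and let $\gcd(I)$ denote the greatest common divisor of the elements of $I$. Then, for all $t>0$, $$f(t,i)>0\ \text{ for } i\in\gcd(I)\,\mathbb{N},\qquad f(t,i)=0\ \text{ for } i\notin\gcd(I)\,\mathbb{N}\quad(i\in\mathbb{N}).$$
   Context: $\mathbb{N}=\{1,2,3,\dots\}$; by convention $\gcd(\emptyset)=0$, and $d\,\mathbb{N}=\{dn:n\in\mathbb{N}\}$. Fix a mesh size $h>0$ and positive real parameters $\alpha_n,\beta_n$ ($n\in\{1,2,3\}$) and $\delta$ with $\delta>\max_{n\in\{1,2,3\}}(\alpha_n+\beta_n)$ and $\delta>2\alpha_1+\beta_1-1$. For $x,y\ge 0$ let $K_n(x,y)=x^{\alpha_n}y^{\alpha_n}(x+y)^{\beta_n}$ and $\gamma(x)=x^\delta$. For $f:\mathbb{N}\to\mathbb{R}$ and $i\in\mathbb{N}$ set $$S^{(1)}_i[f]=\sum_{j=1}^{i-1}K_1(jh,(i-j)h)f_jf_{i-j}-2\sum_{j=1}^\infty K_1(ih,jh)f_if_j,$$ and for $n\in\{2,3\}$ $$S^{(n)}_i[f]=-\sum_{j=1}^{i-1}K_n((i-j)h,jh)f_if_j+\sum_{j=i+1}^\infty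 K_n((j-i)h,ih)f_if_j+\sum_{j=i+1}^\infty K_n(ih,(j-i)h)f_jf_{j-i},$$ $V_i[f]=\gamma(ih)f_i$, $S[f]=S^{(1)}[f]+S^{(2)}[f]+S^{(3)}[f]$, and $O[f]=S[f]-V[f]$. The moments are $m_k\langle f\rangle=\sum_{i=1}^\infty f_i\,(ih)^k$, $k\ge 0$. For $k>\max\{1,2-\alpha_1-\beta_1\}$ and $x\ge0$ define $$\mathcal{B}_k(x)=\Bigl(2\,\mathcal{C}_k\,x^{1+\frac{\delta+k-1}{\delta-2\alpha_1-\beta_1+1}+\frac{\delta}{k-1}}\Bigr)^{\frac{k-1}{\delta+k-1}},$$ where $\mathcal{C}_k$ is the positive constant $$\mathcal{C}_k=\frac{\delta-2\alpha_1-\beta_1+1}{\delta+k-1}\bigl[2^{\beta_1+1}(2^k-2)\bigr]^{\frac{\delta+k-1}{\delta-2\alpha_1-\beta_1+1}}\Bigl(\frac{2(2\alpha_1+\beta_1+k-2)}{\delta+k-1}\Bigr)^{\frac{2\alpha_1+\beta_1+k-2}{\delta-2\alpha_1-\beta_1+1}}.$$ "The solution" with initial datum $f_0$ means the global classical solution $f\in C^1([0,\infty);\ell^1(\mathbb{N}))$ of $\frac{\partial f}{\partial t}=O[f]$, $f(0)=f_0$, which for all $t\ge0$ satisfies $f(t,i)\ge0$, $m_1\langle f(t)\rangle\le m_1\langle f_0\rangle$ and $m_\kappa\langle f(t)\rangle\le\max\{m_\kappa\langle f_0\rangle,2\mathcal{B}_\kappa(m_1\langle f_0\rangle)\}$ (the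 paper's well-posedness theorem gives existence and uniqueness). *)

theory Defs
  imports "HOL-Analysis.Analysis"
begin

text \<open>
  Sequences indexed by \<open>{1, 2, 3, \<dots>}\<close> are functions \<open>nat \<Rightarrow> real\<close> whose value at \<open>0\<close> is
  irrelevant. In the type \<open>ell1\<close> that value is normalised to \<open>0\<close>, so that \<open>ell1\<close> is isometric to
  the space of absolutely summable sequences on the positive integers.
\<close>

typedef ell1 = "{f :: nat \<Rightarrow> real. f 0 = 0 \<and> (\<lambda>i. \<bar>f i\<bar>) summable_on {1..}}"
  morphisms seq Abs_ell1
  by (rule exI[of _ "\<lambda>_. 0"]) simp

setup_lifting type_definition_ell1

lemma abs_summable_add:
  fixes f g :: "nat \<Rightarrow> real"
  assumes "(\<lambda>i. \<bar>f i\<bar>) summable_on A" "(\<lambda>i. \<bar>g i\<bar>) summable_on A"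
  shows "(\<lambda>i. \<bar>f i + g i\<bar>) summable_on A"
  by (rule summable_on_comparison_test[OF summable_on_add[OF assms]]) auto

lemma abs_summable_diff:
  fixes f g :: "nat \<Rightarrow> real"
  assumes "(\<lambda>i. \<bar>f i\<bar>) summable_on A" "(\<lambda>i. \<bar>g i\<bar>) summable_on A"
  shows "(\<lambda>i. \<bar>f i - g i\<bar>) summable_on A"
  using abs_summable_add[of f A "\<lambda>i. - g i"] assms by simp

instantiation ell1 :: real_normed_vector
begin

lift_definition zero_ell1 :: ell1 is "\<lambda>_. 0" by simp

lift_definition plus_ell1 :: "ell1 \<Rightarrow> ell1 \<Rightarrow> ell1" is "\<lambda>f g i. f i + g i"
  by (auto intro: abs_summable_add)

lift_definition minus_ell1 :: "ell1 \<Rightarrow> ell1 \<Rightarrow> ell1" is "\<lambda>f g i. f i - g i"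
  by (auto intro: abs_summable_diff)

lift_definition uminus_ell1 :: "ell1 \<Rightarrow> ell1" is "\<lambda>f i. - f i" by simp

lift_definition scaleR_ell1 :: "real \<Rightarrow> ell1 \<Rightarrow> ell1" is "\<lambda>c f i. c * f i"
  by (auto simp: abs_mult intro: summable_on_cmult_right)

lift_definition norm_ell1 :: "ell1 \<Rightarrow> real" is "\<lambda>f. \<Sum>\<^sub>\<infinity>i\<in>{1..}. \<bar>f i\<bar>" .

definition dist_ell1 :: "ell1 \<Rightarrow> ell1 \<Rightarrow> real"
  where "dist_ell1 x y = norm (x - y)"

definition sgn_ell1 :: "ell1 \<Rightarrow> ell1"
  where "sgn_ell1 x = inverse (norm x) *\<^sub>R x"

definition uniformity_ell1 :: "(ell1 \<times> ell1) filter"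
  where "uniformity_ell1 = (INF e\<in>{0<..}. principal {(x, y). dist x y < e})"

definition open_ell1 :: "ell1 set \<Rightarrow> bool"
  where "open_ell1 U \<longleftrightarrow> (\<forall>x\<in>U. \<forall>\<^sub>F (x', y) in uniformity. x' = x \<longrightarrow> y \<in> U)"

instance
proof
  fix x y z :: ell1 and a b :: real
  show "x + y + z = x + (y + z)" by transfer (simp add: algebra_simps)
  show "x + y = y + x" by transfer (simp add: algebra_simps)
  show "0 + x = x" by transfer simp
  show "- x + x = 0" by transfer simp
  show "x - y = x + - y" by transfer simp
  show "a *\<^sub>R (x + y) = a *\<^sub>R x + a *\<^sub>R y" by transfer (simp add: algebra_simps)
  show "(a + b) *\<^sub>R x = a *\<^sub>R x + b *\<^sub>R x" by transfer (simp add: algebra_simps)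
  show "a *\<^sub>R b *\<^sub>R x = (a * b) *\<^sub>R x" by transfer (simp add: algebra_simps)
  show "1 *\<^sub>R x = x" by transfer simp
  show "dist x y = norm (x - y)" by (rule dist_ell1_def)
  show "sgn x = inverse (norm x) *\<^sub>R x" by (rule sgn_ell1_def)
  show "uniformity = (INF e\<in>{0<..}. principal {(x, y :: ell1). dist x y < e})"
    by (rule uniformity_ell1_def)
  show "open U \<longleftrightarrow> (\<forall>x\<in>U. \<forall>\<^sub>F (x', y) in uniformity. x' = x \<longrightarrow> y \<in> U)" for U :: "ell1 set"
    by (rule open_ell1_def)
  show "norm x = 0 \<longleftrightarrow> x = 0"
  proof transfer
    fix f :: "nat \<Rightarrow> real"
    assume f: "f 0 = 0 \<and> (\<lambda>i. \<bar>f i\<bar>) summable_on {1..}"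
    show "((\<Sum>\<^sub>\<infinity>i\<in>{1..}. \<bar>f i\<bar>) = 0) = (f = (\<lambda>_. 0))"
    proof
      assume s: "(\<Sum>\<^sub>\<infinity>i\<in>{1..}. \<bar>f i\<bar>) = 0"
      have "\<bar>f i\<bar> = 0" if "i \<in> {1..}" for i
        by (rule nonneg_infsum_le_0D[of "\<lambda>i. \<bar>f i\<bar>" "{1..}"]) (use s f that in auto)
      then have "f i = 0" for i using f by (cases i) auto
      then show "f = (\<lambda>_. 0)" by auto
    qed simp
  qed
  show "norm (x + y) \<le> norm x + norm y"
  proof transfer
    fix f g :: "nat \<Rightarrow> real"
    assume "f 0 = 0 \<and> (\<lambda>i. \<bar>f i\<bar>) summable_on {1..}" "g 0 = 0 \<and> (\<lambda>i. \<bar>g i\<bar>) summable_on {1..}"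
    then have f: "(\<lambda>i. \<bar>f i\<bar>) summable_on {1..}" and g: "(\<lambda>i. \<bar>g i\<bar>) summable_on {1..}" by auto
    have "(\<Sum>\<^sub>\<infinity>i\<in>{1..}. \<bar>f i + g i\<bar>) \<le> (\<Sum>\<^sub>\<infinity>i\<in>{1..}. \<bar>f i\<bar> + \<bar>g i\<bar>)"
      by (rule infsum_mono[OF abs_summable_add[OF f g] summable_on_add[OF f g]])
        (rule abs_triangle_ineq)
    also have "\<dots> = (\<Sum>\<^sub>\<infinity>i\<in>{1..}. \<bar>f i\<bar>) + (\<Sum>\<^sub>\<infinity>i\<in>{1..}. \<bar>g i\<bar>)"
      by (rule infsum_add[OF f g])
    finally show "(\<Sum>\<^sub>\<infinity>i\<in>{1..}. \<bar>f i + g i\<bar>) \<le> (\<Sum>\<^sub>\<infinity>i\<in>{1..}. \<bar>f i\<bar>) + (\<Sum>\<^sub>\<infinity>i\<in>{1..}. \<bar>g i\<bar>)" .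
  qed
  show "norm (a *\<^sub>R x) = \<bar>a\<bar> * norm x"
    by transfer (simp add: abs_mult infsum_cmult_right')
qed

end

text \<open>
  Parameters are passed as functions \<open>\<alpha>, \<beta> :: nat \<Rightarrow> real\<close>, of which only the values at
  \<open>1, 2, 3\<close> are used.
\<close>

definition K :: "(nat \<Rightarrow> real) \<Rightarrow> (nat \<Rightarrow> real) \<Rightarrow> nat \<Rightarrow> real \<Rightarrow> real \<Rightarrow> real"
  where "K \<alpha> \<beta> n x y = x powr \<alpha> n * y powr \<alpha> n * (x + y) powr \<beta> n"

definition S1 :: "real \<Rightarrow> (nat \<Rightarrow> real) \<Rightarrow> (nat \<Rightarrow> real) \<Rightarrow> (nat \<Rightarrow> real) \<Rightarrow> nat \<Rightarrow> real"
  where "S1 h \<alpha> \<beta> f i =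
    (\<Sum>j\<in>{1..<i}. K \<alpha> \<beta> 1 (real j * h) (real (i - j) * h) * f j * f (i - j))
    - 2 * (\<Sum>\<^sub>\<infinity>j\<in>{1..}. K \<alpha> \<beta> 1 (real i * h) (real j * h) * f i * f j)"

definition S23 :: "real \<Rightarrow> (nat \<Rightarrow> real) \<Rightarrow> (nat \<Rightarrow> real) \<Rightarrow> nat \<Rightarrow> (nat \<Rightarrow> real) \<Rightarrow> nat \<Rightarrow> real"
  where "S23 h \<alpha> \<beta> n f i =
    - (\<Sum>j\<in>{1..<i}. K \<alpha> \<beta> n (real (i - j) * h) (real j * h) * f i * f j)
    + (\<Sum>\<^sub>\<infinity>j\<in>{i+1..}. K \<alpha> \<beta> n (real (j - i) * h) (real i * h) * f i * f j)
    + (\<Sum>\<^sub>\<infinity>j\<in>{i+1..}. K \<alpha> \<beta> n (real i * h) (real (j - i) * h) * f j * f (j - i))"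

definition V :: "real \<Rightarrow> real \<Rightarrow> (nat \<Rightarrow> real) \<Rightarrow> nat \<Rightarrow> real"
  where "V h \<delta> f i = (real i * h) powr \<delta> * f i"

definition wave_op ::
    "real \<Rightarrow> (nat \<Rightarrow> real) \<Rightarrow> (nat \<Rightarrow> real) \<Rightarrow> real \<Rightarrow> (nat \<Rightarrow> real) \<Rightarrow> nat \<Rightarrow> real"
  where "wave_op h \<alpha> \<beta> \<delta> f i =
    S1 h \<alpha> \<beta> f i + S23 h \<alpha> \<beta> 2 f i + S23 h \<alpha> \<beta> 3 f i - V h \<delta> f i"

text \<open>
  For nonnegative \<open>f\<close>, \<open>finite_moment h k f\<close> says that the \<open>k\<close>-th moment is finite; the real number
  \<open>moment h k f\<close> is meaningful only in that case, as \<open>infsum\<close> is \<open>0\<close> on divergent series.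
\<close>

definition finite_moment :: "real \<Rightarrow> real \<Rightarrow> (nat \<Rightarrow> real) \<Rightarrow> bool"
  where "finite_moment h k f \<longleftrightarrow> (\<lambda>i. f i * (real i * h) powr k) summable_on {1..}"

definition moment :: "real \<Rightarrow> real \<Rightarrow> (nat \<Rightarrow> real) \<Rightarrow> real"
  where "moment h k f = (\<Sum>\<^sub>\<infinity>i\<in>{1..}. f i * (real i * h) powr k)"

definition C_const :: "(nat \<Rightarrow> real) \<Rightarrow> (nat \<Rightarrow> real) \<Rightarrow> real \<Rightarrow> real \<Rightarrow> real"
  where "C_const \<alpha> \<beta> \<delta> k =
    (\<delta> - 2 * \<alpha> 1 - \<beta> 1 + 1) / (\<delta> + k - 1)
    * (2 powr (\<beta> 1 + 1) * (2 powr k - 2)) powr ((\<delta> + k - 1) / (\<delta> - 2 * \<alpha> 1 - \<beta> 1 + 1))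
    * (2 * (2 * \<alpha> 1 + \<beta> 1 + k - 2) / (\<delta> + k - 1))
        powr ((2 * \<alpha> 1 + \<beta> 1 + k - 2) / (\<delta> - 2 * \<alpha> 1 - \<beta> 1 + 1))"

definition B_bound :: "(nat \<Rightarrow> real) \<Rightarrow> (nat \<Rightarrow> real) \<Rightarrow> real \<Rightarrow> real \<Rightarrow> real \<Rightarrow> real"
  where "B_bound \<alpha> \<beta> \<delta> k x =
    (2 * C_const \<alpha> \<beta> \<delta> k
      * x powr (1 + (\<delta> + k - 1) / (\<delta> - 2 * \<alpha> 1 - \<beta> 1 + 1) + \<delta> / (k - 1)))
    powr ((k - 1) / (\<delta> + k - 1))"

text \<open>
  Only the restriction of \<open>f\<close> to \<open>{0..}\<close> matters: derivatives and continuity are taken within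
  \<open>{0..}\<close>, in the \<open>ell1\<close> norm.
\<close>

definition is_solution ::
    "real \<Rightarrow> (nat \<Rightarrow> real) \<Rightarrow> (nat \<Rightarrow> real) \<Rightarrow> real \<Rightarrow> real \<Rightarrow> (nat \<Rightarrow> real) \<Rightarrow> (real \<Rightarrow> ell1) \<Rightarrow> bool"
  where "is_solution h \<alpha> \<beta> \<delta> \<kappa> f0 f \<longleftrightarrow>
    (\<exists>f'. continuous_on {0..} f' \<and>
      (\<forall>t\<ge>0. (f has_vector_derivative f' t) (at t within {0..}) \<and>
             (\<forall>i\<ge>1. seq (f' t) i = wave_op h \<alpha> \<beta> \<delta> (seq (f t)) i))) \<and>
    (\<forall>i\<ge>1. seq (f 0) i = f0 i) \<and>
    (\<forall>t\<ge>0.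
      (\<forall>i\<ge>1. seq (f t) i \<ge> 0) \<and>
      finite_moment h 1 (seq (f t)) \<and> moment h 1 (seq (f t)) \<le> moment h 1 f0 \<and>
      finite_moment h \<kappa> (seq (f t)) \<and>
      moment h \<kappa> (seq (f t)) \<le> max (moment h \<kappa> f0) (2 * B_bound \<alpha> \<beta> \<delta> \<kappa> (moment h 1 f0)))"

end

theory Submission
  imports Defs
begin

text \<open>
  Each component satisfies \<open>f\<^sub>i' \<ge> gain - C\<^sub>i f\<^sub>i\<close> with \<open>C\<^sub>i\<close> uniform in time, so positivity persists. At
  a time \<open>t > 0\<close> a zero of \<open>f\<^sub>i\<close> forces \<open>f\<^sub>i' = 0\<close>, which excludes any positive gain: the term
  \<open>f\<^sub>a f\<^sub>b\<close> gives a gain at \<open>a + b\<close>, and \<open>f\<^sub>a f\<^sub>b\<close> with \<open>b < a\<close> gives one at \<open>a - b\<close>. The positivity set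
  at time \<open>t\<close> is therefore closed under sums and positive differences, so it contains all multiples
  of the greatest common divisor \<open>d\<close> of the initial support.

  For the vanishing part, let \<open>g\<close> be the sum of \<open>f\<^sub>i\<close> over \<open>i \<le> N\<close> not divisible by \<open>d\<close>. The
  contribution of \<open>S\<^sup>(\<^sup>1\<^sup>)\<close> to \<open>g'\<close> is nonpositive. The gains of \<open>S\<^sup>(\<^sup>2\<^sup>)\<close> and \<open>S\<^sup>(\<^sup>3\<^sup>)\<close> are dominated by
  their losses up to terms of size \<open>(ih)\<^sup>\<alpha> f\<^sub>i\<close>, which the damping \<open>(ih)\<^sup>\<delta> f\<^sub>i\<close> absorbs, and up to an error
  from indices beyond \<open>N\<close>, which tends to \<open>0\<close> by the bound on the \<open>\<kappa>\<close>-th moment. Gronwall's inequality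
  and \<open>N \<rightarrow> \<infinity>\<close> give \<open>g = 0\<close>.
\<close>

section \<open>Divisibility of indices and counting of pairs\<close>

text \<open>Repeated subtraction of the least element \<open>m\<close> of \<open>Q\<close>, as in
  Euclid's algorithm, shows that \<open>m\<close> divides every element of \<open>Q\<close>, hence
  also \<open>Gcd I\<close> and \<open>i\<close>; sums then produce all positive multiples of
  \<open>m\<close>.\<close>

lemma additive_subtractive_contains_multiples:
  fixes Q I :: "nat set"
  assumes pos: "\<And>a. a \<in> Q \<Longrightarrow> a \<ge> 1"
    and add: "\<And>a b. a \<in> Q \<Longrightarrow> b \<in> Q \<Longrightarrow> a + b \<in> Q"
    and diff: "\<And>a b. a \<in> Q \<Longrightarrow> b \<in> Q \<Longrightarrow> b < a \<Longrightarrow> a - b \<in> Q"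
    and "I \<subseteq> Q" "Gcd I dvd i" "i \<ge> 1"
  shows "i \<in> Q"
proof -
  \<comment> \<open>Zero divides only zero, so \<open>i \<ge> 1\<close> makes \<open>I\<close>, and
    with it \<open>Q\<close>, nonempty.\<close>
  have "Gcd I \<noteq> 0" using assms(5,6) by (metis dvd_0_left not_one_le_zero)
  then have "I \<noteq> {}" by (metis Gcd_empty)
  then have ex: "\<exists>a. a \<in> Q" using assms(4) by auto
  define m where "m = (LEAST a. a \<in> Q)"
  have m: "m \<in> Q" unfolding m_def using ex by (rule LeastI_ex)
  have m_le: "m \<le> a" if "a \<in> Q" for a unfolding m_def using that by (rule Least_le)
  have m_dvd: "m dvd a" if "a \<in> Q" for a
    using that
  proof (induction a rule: less_induct)
    case (less a)
    show ?case
    proof (cases "a = m")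
      case False
      then have "m < a" using m_le[OF less.prems] by simp
      then have "m dvd a - m"
        using less.IH[of "a - m"] diff[OF less.prems m] pos[OF m] by simp
      then show ?thesis using \<open>m < a\<close> by (metis dvd_diffD1 dvd_refl less_imp_le_nat dvd_minus_self not_less)
    qed simp
  qed
  have "m dvd Gcd I" using assms(4) m_dvd by (auto intro: Gcd_greatest)
  then obtain k where k: "i = m * k" using assms(5) dvd_trans by blast
  \<comment> \<open>\<open>Suc l\<close> leaves out the multiple 0, which \<open>pos\<close> keeps
    out of \<open>Q\<close>.\<close>
  have "m * Suc l \<in> Q" for l
    by (induction l) (use m add in auto)
  then show ?thesis using k assms(6) by (cases k) auto
qed

text \<open>If \<open>d\<close> does not divide \<open>i\<close>, then it fails to divide \<open>j\<close> or \<open>i - j\<close>, and these two cases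
  are exchanged by \<open>j \<mapsto> i - j\<close>; hence the factor 2, which is the one in front of the loss term of
  \<open>S1\<close>.\<close>

lemma coagulation_sum_le:
  fixes \<phi> :: "nat \<Rightarrow> nat \<Rightarrow> real"
  assumes nn: "\<And>i j. \<phi> i j \<ge> 0" and sym: "\<And>i j. \<phi> i j = \<phi> j i"
    and D: "D = {i\<in>{1..N}. \<not> d dvd i}"
  shows "(\<Sum>i\<in>D. \<Sum>j\<in>{1..<i}. \<phi> j (i - j)) \<le> 2 * (\<Sum>i\<in>D. \<Sum>j\<in>{1..N}. \<phi> i j)"
proof -
  have fin: "finite D" unfolding D by simp
  have half: "(\<Sum>j\<in>{1..<i}. \<phi> j (i - j)) \<le> 2 * (\<Sum>j\<in>{j\<in>D. j < i}. \<phi> j (i - j))" if "i \<in> D" for i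
  proof -
    let ?J = "{j\<in>{1..<i}. j \<in> D}" and ?L = "{j\<in>{1..<i}. i - j \<in> D}"
    have un: "{1..<i} = ?J \<union> ?L"
    proof -
      have "j \<in> D \<or> i - j \<in> D" if "j \<in> {1..<i}" for j
      proof (rule ccontr)
        assume "\<not> ?thesis"
        then have "d dvd j" "d dvd i - j" using that \<open>i \<in> D\<close> unfolding D by auto
        then have "d dvd j + (i - j)" by (rule dvd_add)
        then show False using that \<open>i \<in> D\<close> unfolding D by auto
      qed
      then show ?thesis by blast
    qed
    have "(\<Sum>j\<in>{1..<i}. \<phi> j (i - j)) \<le> (\<Sum>j\<in>?J. \<phi> j (i - j)) + (\<Sum>j\<in>?L. \<phi> j (i - j))"
      by (subst un, subst sum.union_inter[symmetric]) (auto intro!: sum_nonneg nn)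
    also have "(\<Sum>j\<in>?L. \<phi> j (i - j)) = (\<Sum>j\<in>?J. \<phi> j (i - j))"
      by (rule sum.reindex_bij_witness[of _ "\<lambda>j. i - j" "\<lambda>j. i - j"]) (auto simp: sym)
    also have "?J = {j\<in>D. j < i}" unfolding D by auto
    finally show ?thesis by simp
  qed
  have "(\<Sum>i\<in>D. \<Sum>j\<in>{1..<i}. \<phi> j (i - j)) \<le> (\<Sum>i\<in>D. 2 * (\<Sum>j\<in>{j\<in>D. j < i}. \<phi> j (i - j)))"
    by (rule sum_mono) (rule half)
  also have "\<dots> = 2 * (\<Sum>j\<in>D. \<Sum>i\<in>{i\<in>D. j < i}. \<phi> j (i - j))"
    unfolding sum_distrib_left[symmetric] by (subst sum.swap_restrict[OF fin fin]) simp
  also have "(\<Sum>j\<in>D. \<Sum>i\<in>{i\<in>D. j < i}. \<phi> j (i - j)) \<le> (\<Sum>j\<in>D. \<Sum>i\<in>{1..N}. \<phi> j i)"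
  proof (rule sum_mono)
    fix j assume "j \<in> D"
    have "(\<Sum>i\<in>{i\<in>D. j < i}. \<phi> j (i - j)) = (\<Sum>b\<in>(\<lambda>i. i - j) ` {i\<in>D. j < i}. \<phi> j b)"
      by (subst sum.reindex) (auto intro!: inj_onI)
    also have "\<dots> \<le> (\<Sum>i\<in>{1..N}. \<phi> j i)"
      by (rule sum_mono2) (auto simp: D nn)
    finally show "(\<Sum>i\<in>{i\<in>D. j < i}. \<phi> j (i - j)) \<le> (\<Sum>i\<in>{1..N}. \<phi> j i)" .
  qed
  finally show ?thesis by simp
qed

section \<open>Kernel bounds, absorption of powers, infinite sums\<close>

lemma K_nonneg: "K \<alpha> \<beta> n x y \<ge> 0"
  unfolding K_def by simp

lemma K_commute: "K \<alpha> \<beta> n x y = K \<alpha> \<beta> n y x"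
  unfolding K_def by (simp add: add.commute)

text \<open>Only one of the two factors of order \<open>\<alpha> n\<close> is enlarged to a power of
  \<open>x + y\<close>. The other stays free, so that double sums separate into a moment of order
  \<open>\<alpha> n + \<beta> n\<close> and one of order \<open>\<alpha> n\<close>.\<close>

lemma K_le:
  assumes "x \<ge> 0" "y \<ge> 0" "\<alpha> n \<ge> 0"
  shows "K \<alpha> \<beta> n x y \<le> (x + y) powr (\<alpha> n + \<beta> n) * y powr \<alpha> n"
proof -
  have "x powr \<alpha> n \<le> (x + y) powr \<alpha> n" using assms by (intro powr_mono2) auto
  then have "x powr \<alpha> n * (y powr \<alpha> n * (x + y) powr \<beta> n)
      \<le> (x + y) powr \<alpha> n * (y powr \<alpha> n * (x + y) powr \<beta> n)"
    by (intro mult_right_mono) auto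
  then show ?thesis unfolding K_def by (simp add: powr_add mult_ac)
qed

text \<open>Beyond the threshold \<open>R\<close> the higher power wins, and below it the constant
  suffices. Only half of \<open>x powr \<delta>\<close> is spent, which leaves room for a second
  such term.\<close>

lemma powr_absorb:
  fixes a \<delta> A :: real
  assumes "0 < a" "a < \<delta>" "A \<ge> 0"
  obtains C where "C \<ge> 0" "\<And>x. x \<ge> 0 \<Longrightarrow> A * x powr a \<le> x powr \<delta> / 2 + C"
proof
  \<comment> \<open>\<open>R\<close> is the point where
    \<open>A * R powr a = R powr \<delta> / 2\<close>.\<close>
  define R where "R = (2 * A) powr (1 / (\<delta> - a))"
  show "A * R powr a \<ge> 0" using assms by simp
  fix x :: real assume x: "x \<ge> 0"
  show "A * x powr a \<le> x powr \<delta> / 2 + A * R powr a"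
  proof (cases "x \<le> R")
    case True
    then have "x powr a \<le> R powr a" using assms x by (intro powr_mono2) auto
    then have "A * x powr a \<le> A * R powr a" using assms by (intro mult_left_mono) auto
    then show ?thesis using powr_ge_zero[of x \<delta>] by linarith
  next
    case False
    have "2 * A = R powr (\<delta> - a)" unfolding R_def using assms by (simp add: powr_powr)
    also have "\<dots> \<le> x powr (\<delta> - a)" using False assms by (intro powr_mono2) (auto simp: R_def)
    finally have "2 * A * x powr a \<le> x powr (\<delta> - a) * x powr a" by (intro mult_right_mono) auto
    also have "\<dots> = x powr \<delta>" by (simp add: powr_add[symmetric])
    finally show ?thesis using \<open>A * R powr a \<ge> 0\<close> by linarith
  qed
qed

lemma has_sum_sum:
  fixes g :: "'i \<Rightarrow> 'j \<Rightarrow> real"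
  assumes "finite D" "\<And>i. i \<in> D \<Longrightarrow> (g i has_sum s i) A"
  shows "((\<lambda>j. \<Sum>i\<in>D. g i j) has_sum (\<Sum>i\<in>D. s i)) A"
  using assms by (induction D rule: finite_induct) (auto intro: has_sum_add)

lemma summable_on_nonneg_le:
  fixes f g :: "'a \<Rightarrow> real"
  assumes "g summable_on A" "\<And>x. x \<in> A \<Longrightarrow> 0 \<le> f x" "\<And>x. x \<in> A \<Longrightarrow> f x \<le> g x"
  shows "f summable_on A"
  by (rule summable_on_comparison_test[OF assms(1)]) (use assms in auto)

lemma infsum_split_at:
  fixes f :: "nat \<Rightarrow> real"
  assumes "f summable_on {i + 1..}" "i \<le> N"
  shows "infsum f {i + 1..} = sum f {i + 1..N} + infsum f {N + 1..}"
proof -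
  have "{i + 1..} = {i + 1..N} \<union> {N + 1..}" using assms(2) by auto
  moreover have "f summable_on {N + 1..}"
    using assms by (elim summable_on_subset_banach) auto
  ultimately show ?thesis by (simp add: infsum_Un_disjoint del: One_nat_def)
qed

section \<open>Moment and kernel estimates at a fixed time\<close>

text \<open>\<open>u\<close> is the solution frozen at one time. The constants below depend on
  \<open>u\<close> only through its moments, so that moment bounds uniform in time will make them
  uniform as well.\<close>

locale moment_sequence =
  fixes h \<kappa> :: real and u :: "nat \<Rightarrow> real"
  assumes h_pos: "h > 0"
    and u_nonneg: "i \<ge> 1 \<Longrightarrow> u i \<ge> 0"
    and finite_moment: "finite_moment h \<kappa> u"
begin

text \<open>A power with exponent \<open>p - q \<le> 0\<close> decreases in \<open>i\<close>. Since
  the grid points stay away from 0, high moments control low ones.\<close>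

lemma powr_le_powr:
  assumes "p \<le> q" "1 \<le> m" "m \<le> i"
  shows "(real i * h) powr p \<le> (real m * h) powr (p - q) * (real i * h) powr q"
proof -
  have "(real i * h) powr (p - q) \<le> (real m * h) powr (p - q)"
    using assms h_pos by (intro powr_mono2') auto
  then have "(real i * h) powr (p - q) * (real i * h) powr q
      \<le> (real m * h) powr (p - q) * (real i * h) powr q"
    by (intro mult_right_mono) auto
  then show ?thesis by (simp add: powr_add[symmetric])
qed

lemma moment_term_nonneg: "i \<ge> 1 \<Longrightarrow> u i * (real i * h) powr p \<ge> 0"
  using u_nonneg by simp

lemma moment_term_le:
  assumes "p \<le> \<kappa>" "1 \<le> m" "m \<le> i"
  shows "u i * (real i * h) powr p \<le> (real m * h) powr (p - \<kappa>) * (u i * (real i * h) powr \<kappa>)"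
  using mult_left_mono[OF powr_le_powr[OF assms] u_nonneg[of i]] assms by (simp add: mult_ac)

lemma summable_moment:
  assumes "p \<le> \<kappa>"
  shows "(\<lambda>i. u i * (real i * h) powr p) summable_on {1..}"
proof (rule summable_on_nonneg_le)
  show "(\<lambda>i. (real 1 * h) powr (p - \<kappa>) * (u i * (real i * h) powr \<kappa>)) summable_on {1..}"
    using finite_moment unfolding finite_moment_def by (rule summable_on_cmult_right)
qed (use moment_term_nonneg moment_term_le[OF assms, of 1] in auto)

lemma moment_nonneg: "moment h p u \<ge> 0"
  unfolding moment_def by (rule infsum_nonneg) (simp add: u_nonneg)

text \<open>For \<open>p < \<kappa>\<close> the factor in front tends to 0 as \<open>m\<close>
  grows, which makes the truncation error vanish; \<open>m = 1\<close> compares whole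
  moments.\<close>

lemma moment_tail_le:
  assumes "p \<le> \<kappa>" "m \<ge> 1"
  shows "(\<Sum>\<^sub>\<infinity>i\<in>{m..}. u i * (real i * h) powr p) \<le> (real m * h) powr (p - \<kappa>) * moment h \<kappa> u"
proof -
  let ?f = "\<lambda>q i. u i * (real i * h) powr q"
  have sub: "?f q summable_on {m..}" if "q \<le> \<kappa>" for q
    using summable_moment[OF that] by (rule summable_on_subset_banach) (use assms in auto)
  have "infsum (?f p) {m..} \<le> (\<Sum>\<^sub>\<infinity>i\<in>{m..}. (real m * h) powr (p - \<kappa>) * ?f \<kappa> i)"
    using assms moment_term_le[OF assms] by (intro infsum_mono sub summable_on_cmult_right) auto
  also have "\<dots> = (real m * h) powr (p - \<kappa>) * infsum (?f \<kappa>) {m..}"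
    by (rule infsum_cmult_right')
  also have "\<dots> \<le> (real m * h) powr (p - \<kappa>) * moment h \<kappa> u"
    unfolding moment_def
    by (intro mult_left_mono infsum_mono2 sub summable_moment) (use assms in \<open>auto simp: u_nonneg\<close>)
  finally show ?thesis .
qed

lemma moment_le:
  assumes "p \<le> \<kappa>"
  shows "moment h p u \<le> h powr (p - \<kappa>) * moment h \<kappa> u"
  using moment_tail_le[OF assms, of 1] by (simp add: moment_def)

lemma sum_le_moment:
  assumes "p \<le> \<kappa>" "finite F" "F \<subseteq> {1..}"
  shows "(\<Sum>i\<in>F. u i * (real i * h) powr p) \<le> moment h p u"
  unfolding moment_def
  by (rule finite_sum_le_infsum) (use assms summable_moment u_nonneg in auto)

lemma infsum_le_moment:
  assumes "p \<le> \<kappa>" "m \<ge> 1"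
  shows "(\<Sum>\<^sub>\<infinity>i\<in>{m..}. u i * (real i * h) powr p) \<le> moment h p u"
  unfolding moment_def
  by (intro infsum_mono2 summable_on_subset_banach[OF summable_moment] summable_moment)
    (use assms u_nonneg in auto)

end

section \<open>Bounds for the single interaction terms\<close>

locale kernel_sequence = moment_sequence +
  fixes \<alpha> \<beta> :: "nat \<Rightarrow> real" and n :: nat
  assumes exponents: "\<alpha> n > 0" "\<beta> n > 0" "\<alpha> n + \<beta> n < \<kappa>"
begin

abbreviation "k i j \<equiv> K \<alpha> \<beta> n (real i * h) (real j * h)"
text \<open>The two exponents into which the kernel bound splits: \<open>p\<close> belongs to the
  free factor and \<open>q\<close> to the total size.\<close>

abbreviation "p \<equiv> \<alpha> n"
abbreviation "q \<equiv> \<alpha> n + \<beta> n"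

lemma p_le: "p \<le> \<kappa>" and q_le: "q \<le> \<kappa>"
  using exponents by auto

lemma kernel_le: "k i j \<le> (real (i + j) * h) powr q * (real j * h) powr p"
  using K_le[of "real i * h" "real j * h" \<alpha> n \<beta>] exponents h_pos by (simp add: distrib_right)

lemma kernel_le':
  assumes "i \<le> j"
  shows "k i (j - i) \<le> (real j * h) powr q * (real (j - i) * h) powr p"
    and "k (j - i) i \<le> (real j * h) powr q * (real i * h) powr p"
  using kernel_le[of i "j - i"] kernel_le[of "j - i" i] assms by auto

text \<open>The kernel arguments add up to \<open>real j * h\<close>, so the power \<open>q\<close>
  attaches to \<open>u j\<close>; the free power is put on \<open>j - i\<close>, where the second
  entry sits.\<close>

lemma fragment_term_le:
  assumes "1 \<le> i" "i < j"
  shows "k i (j - i) * u j * u (j - i)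
    \<le> (u j * (real j * h) powr q) * (u (j - i) * (real (j - i) * h) powr p)"
proof -
  have "k i (j - i) * (u j * u (j - i))
      \<le> ((real j * h) powr q * (real (j - i) * h) powr p) * (u j * u (j - i))"
    using kernel_le'(1)[of i j] u_nonneg assms by (intro mult_right_mono) auto
  then show ?thesis by (simp only: mult_ac)
qed

lemma fragment_term_nonneg:
  assumes "1 \<le> i" "i < j"
  shows "0 \<le> k i (j - i) * u j * u (j - i)"
  using u_nonneg assms K_nonneg by simp

lemma summable_fragment:
  assumes "1 \<le> i"
  shows "(\<lambda>j. k i (j - i) * u j * u (j - i)) summable_on {i + 1..}"
proof (rule summable_on_nonneg_le)
  show "(\<lambda>j. (u j * (real j * h) powr q) * moment h p u) summable_on {i + 1..}"
    by (rule summable_on_cmult_left[OF summable_on_subset_banach[OF summable_moment[OF q_le]]]) auto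
next
  fix j assume j: "j \<in> {i + 1..}"
  \<comment> \<open>A single weighted entry is at most the whole moment, which removes the shifted
    index.\<close>
  have "u (j - i) * (real (j - i) * h) powr p \<le> moment h p u"
    using sum_le_moment[OF p_le, of "{j - i}"] j by auto
  then have "(u j * (real j * h) powr q) * (u (j - i) * (real (j - i) * h) powr p)
     \<le> (u j * (real j * h) powr q) * moment h p u"
    using moment_term_nonneg j by (intro mult_left_mono) auto
  then show "k i (j - i) * u j * u (j - i) \<le> (u j * (real j * h) powr q) * moment h p u"
    using fragment_term_le[of i j] j assms by simp
qed (use fragment_term_nonneg assms in auto)

text \<open>Here the free power falls on \<open>i\<close> instead of \<open>j - i\<close>, so that
  summation over \<open>j\<close> leaves one weighted entry \<open>u i\<close> in front of a
  moment.\<close>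

lemma transfer_term_le:
  assumes "1 \<le> i" "i < j"
  shows "k (j - i) i * u i * u j \<le> (u i * (real i * h) powr p) * (u j * (real j * h) powr q)"
proof -
  have "k (j - i) i * (u i * u j) \<le> ((real j * h) powr q * (real i * h) powr p) * (u i * u j)"
    using kernel_le'(2)[of i j] u_nonneg assms by (intro mult_right_mono) auto
  then show ?thesis by (simp only: mult_ac)
qed

lemma infsum_transfer_le:
  assumes "1 \<le> i"
  shows "(\<Sum>\<^sub>\<infinity>j\<in>{i + 1..}. k (j - i) i * u i * u j) \<le> (u i * (real i * h) powr p) * moment h q u"
proof -
  have s: "(\<lambda>j. (u i * (real i * h) powr p) * (u j * (real j * h) powr q)) summable_on {i + 1..}"
    by (rule summable_on_cmult_right[OF summable_on_subset_banach[OF summable_moment[OF q_le]]]) auto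
  have "(\<Sum>\<^sub>\<infinity>j\<in>{i + 1..}. k (j - i) i * u i * u j)
     \<le> (\<Sum>\<^sub>\<infinity>j\<in>{i + 1..}. (u i * (real i * h) powr p) * (u j * (real j * h) powr q))"
    by (rule infsum_mono[OF summable_on_nonneg_le[OF s] s])
      (use assms transfer_term_le u_nonneg K_nonneg in auto)
  also have "\<dots> = (u i * (real i * h) powr p) * (\<Sum>\<^sub>\<infinity>j\<in>{i + 1..}. u j * (real j * h) powr q)"
    by (rule infsum_cmult_right')
  also have "\<dots> \<le> (u i * (real i * h) powr p) * moment h q u"
    by (rule mult_left_mono[OF infsum_le_moment[OF q_le] moment_term_nonneg]) (use assms in auto)
  finally show ?thesis .
qed

text \<open>For positive indices \<open>i + j \<le> (i + 1) * j\<close>, which decouples the power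
  of the sum. The constant depends on \<open>i\<close> alone, so the loss of \<open>i\<close>
  becomes a rate times \<open>u i\<close>.\<close>

lemma collision_le:
  assumes "1 \<le> i" "1 \<le> j"
  shows "k i j * u j
    \<le> (real (i + 1) powr q * (real i * h) powr p) * (u j * (real j * h) powr q)"
proof -
  have "i * 1 \<le> i * j" using assms by (intro mult_left_mono) auto
  then have "i + j \<le> (i + 1) * j" by simp
  then have "real (i + j) \<le> real (i + 1) * real j" by (metis of_nat_le_iff of_nat_mult)
  then have "real (i + j) * h \<le> real (i + 1) * (real j * h)"
    using h_pos by (metis mult.assoc mult_right_mono less_imp_le)
  then have "(real (j + i) * h) powr q \<le> (real (i + 1) * (real j * h)) powr q"
    using exponents h_pos by (intro powr_mono2) (auto simp: add.commute)
  also have "\<dots> = real (i + 1) powr q * (real j * h) powr q"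
    using h_pos by (simp add: powr_mult)
  finally have "(real (j + i) * h) powr q * (real i * h) powr p
    \<le> real (i + 1) powr q * (real j * h) powr q * (real i * h) powr p"
    by (intro mult_right_mono) auto
  then have "k i j \<le> real (i + 1) powr q * (real j * h) powr q * (real i * h) powr p"
    using kernel_le[of j i] K_commute[of \<alpha> \<beta> n "real i * h"] by simp
  then have "k i j * u j \<le> real (i + 1) powr q * (real j * h) powr q * (real i * h) powr p * u j"
    using u_nonneg assms by (intro mult_right_mono) auto
  then show ?thesis by (simp only: mult_ac)
qed

lemma summable_collision:
  assumes "1 \<le> i"
  shows "(\<lambda>j. k i j * u j) summable_on {1..}"
  by (rule summable_on_nonneg_le[OF summable_on_cmult_right[OF summable_moment[OF q_le]]])
    (use collision_le u_nonneg K_nonneg assms in auto)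

lemma infsum_collision_le:
  assumes "1 \<le> i"
  shows "(\<Sum>\<^sub>\<infinity>j\<in>{1..}. k i j * u j)
    \<le> (real (i + 1) powr q * (real i * h) powr p) * moment h q u"
proof -
  have "(\<Sum>\<^sub>\<infinity>j\<in>{1..}. k i j * u j)
    \<le> (\<Sum>\<^sub>\<infinity>j\<in>{1..}. (real (i + 1) powr q * (real i * h) powr p) * (u j * (real j * h) powr q))"
    by (intro infsum_mono summable_collision summable_on_cmult_right summable_moment q_le)
      (use assms collision_le in auto)
  then show ?thesis by (simp add: infsum_cmult_right' moment_def del: of_nat_add)
qed

lemma sum_loss_le:
  "(\<Sum>j\<in>{1..<i}. k (i - j) j * u j) \<le> (real i * h) powr q * moment h p u"
proof -
  have "(\<Sum>j\<in>{1..<i}. k (i - j) j * u j) \<le> (\<Sum>j\<in>{1..<i}. (real i * h) powr q * (u j * (real j * h) powr p))"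
  proof (rule sum_mono)
    fix j assume j: "j \<in> {1..<i}"
    have "k (i - j) j * u j \<le> (real i * h) powr q * (real j * h) powr p * u j"
      using kernel_le'(2)[of j i] j u_nonneg by (intro mult_right_mono) auto
    then show "k (i - j) j * u j \<le> (real i * h) powr q * (u j * (real j * h) powr p)"
      by (simp only: mult_ac)
  qed
  also have "\<dots> \<le> (real i * h) powr q * moment h p u"
    unfolding sum_distrib_left[symmetric]
    by (intro mult_left_mono sum_le_moment p_le) auto
  finally show ?thesis .
qed

section \<open>Sums over the truncated set of non-multiples\<close>

text \<open>The gains amount to at most twice the collisions of \<open>D\<close> with partners up to
  \<open>N\<close>. The loss counts collisions with all partners, hence is at least as
  large.\<close>

lemma S1_sum_le:
  assumes n: "n = 1" and D: "D = {i\<in>{1..N}. \<not> d dvd i}"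
  shows "(\<Sum>i\<in>D. S1 h \<alpha> \<beta> u i) \<le> 0"
proof -
  \<comment> \<open>The guard is there because \<open>u\<close> is known to be nonnegative only at
    positive indices, whereas the counting argument wants a function nonnegative everywhere.\<close>
  let ?\<phi> = "\<lambda>i j. if i \<ge> 1 \<and> j \<ge> 1 then k i j * u i * u j else 0"
  have "(\<Sum>i\<in>D. \<Sum>j\<in>{1..<i}. ?\<phi> j (i - j)) \<le> 2 * (\<Sum>i\<in>D. \<Sum>j\<in>{1..N}. ?\<phi> i j)"
    by (rule coagulation_sum_le[OF _ _ D])
      (auto simp: K_nonneg u_nonneg K_commute[of \<alpha> \<beta> n "real i * h" "real j * h" for i j])
  also have "\<dots> \<le> 2 * (\<Sum>i\<in>D. \<Sum>\<^sub>\<infinity>j\<in>{1..}. k i j * u i * u j)"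
  proof (intro mult_left_mono sum_mono)
    fix i assume "i \<in> D"
    then have i: "1 \<le> i" unfolding D by auto
    have "(\<Sum>j\<in>{1..N}. ?\<phi> i j) = (\<Sum>j\<in>{1..N}. k i j * u i * u j)"
      using i by (intro sum.cong) auto
    also have "\<dots> \<le> (\<Sum>\<^sub>\<infinity>j\<in>{1..}. k i j * u i * u j)"
    proof (rule finite_sum_le_infsum)
      show "(\<lambda>j. k i j * u i * u j) summable_on {1..}"
        using summable_on_cmult_right[OF summable_collision[OF i], of "u i"] by (simp add: mult_ac)
    qed (use i u_nonneg K_nonneg in auto)
    finally show "(\<Sum>j\<in>{1..N}. ?\<phi> i j) \<le> (\<Sum>\<^sub>\<infinity>j\<in>{1..}. k i j * u i * u j)" .
  qed simp
  also have "(\<Sum>i\<in>D. \<Sum>j\<in>{1..<i}. ?\<phi> j (i - j))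
      = (\<Sum>i\<in>D. \<Sum>j\<in>{1..<i}. k j (i - j) * u j * u (i - j))"
    by (intro sum.cong) auto
  finally show ?thesis
    unfolding S1_def sum_subtractf sum_distrib_left[symmetric] using n by simp
qed

text \<open>The gains with \<open>\<not> d dvd j\<close> are dominated by the loss of \<open>j\<close>; in those with \<open>d dvd j\<close> the other
  factor \<open>u (j - i)\<close> has \<open>\<not> d dvd j - i\<close>.\<close>

lemma fragment_sum_le:
  assumes D: "D = {i\<in>{1..N}. \<not> d dvd i}"
  shows "(\<Sum>i\<in>D. \<Sum>j\<in>{i + 1..N}. k i (j - i) * u j * u (j - i))
    \<le> (\<Sum>i\<in>D. \<Sum>j\<in>{1..<i}. k (i - j) j * u i * u j)
      + moment h q u * (\<Sum>i\<in>D. u i * (real i * h) powr p)"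
proof -
  let ?G = "\<Sum>i\<in>D. u i * (real i * h) powr p"
  let ?A = "\<lambda>j. \<Sum>i\<in>{i\<in>D. i < j}. k i (j - i) * u j * u (j - i)"
  have fin: "finite D" unfolding D by simp
  have G: "?G \<ge> 0" using moment_term_nonneg D by (intro sum_nonneg) auto
  have "(\<Sum>i\<in>D. \<Sum>j\<in>{i + 1..N}. k i (j - i) * u j * u (j - i))
      = (\<Sum>i\<in>D. \<Sum>j\<in>{j\<in>{1..N}. i < j}. k i (j - i) * u j * u (j - i))"
    by (intro sum.cong) auto
  also have "\<dots> = (\<Sum>j\<in>{1..N}. ?A j)"
    by (rule sum.swap_restrict) (use fin in auto)
  also have "\<dots> = (\<Sum>j\<in>D. ?A j) + (\<Sum>j\<in>{1..N} - D. ?A j)"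
    by (subst sum.subset_diff[of D]) (auto simp: D)
  finally have split: "(\<Sum>i\<in>D. \<Sum>j\<in>{i + 1..N}. k i (j - i) * u j * u (j - i))
      = (\<Sum>j\<in>D. ?A j) + (\<Sum>j\<in>{1..N} - D. ?A j)" .
  have loss: "(\<Sum>j\<in>D. ?A j) \<le> (\<Sum>i\<in>D. \<Sum>j\<in>{1..<i}. k (i - j) j * u i * u j)"
  proof (rule sum_mono)
    fix j assume "j \<in> D"
    have "?A j \<le> (\<Sum>i\<in>{1..<j}. k i (j - i) * u j * u (j - i))"
      by (rule sum_mono2) (auto simp: D K_nonneg u_nonneg)
    also have "\<dots> = (\<Sum>i\<in>{1..<j}. k (j - i) i * u j * u i)"
      by (rule sum.reindex_bij_witness[of _ "\<lambda>i. j - i" "\<lambda>i. j - i"]) auto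
    finally show "?A j \<le> (\<Sum>i\<in>{1..<j}. k (j - i) i * u j * u i)" .
  qed
  have "(\<Sum>j\<in>{1..N} - D. ?A j) \<le> (\<Sum>j\<in>{1..N} - D. (u j * (real j * h) powr q) * ?G)"
  proof (rule sum_mono)
    fix j assume j: "j \<in> {1..N} - D"
    have inD: "j - i \<in> D" if "i \<in> D" "i < j" for i
    proof -
      have "d dvd j" using j unfolding D by auto
      moreover have "\<not> d dvd i" using that unfolding D by auto
      ultimately have "\<not> d dvd j - i" using that by (metis dvd_diffD1 less_imp_le_nat)
      then show ?thesis using j that unfolding D by auto
    qed
    have "?A j \<le> (\<Sum>i\<in>{i\<in>D. i < j}.
        (u j * (real j * h) powr q) * (u (j - i) * (real (j - i) * h) powr p))"
      by (rule sum_mono, rule fragment_term_le) (auto simp: D)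
    also have "\<dots> = (u j * (real j * h) powr q)
        * (\<Sum>i\<in>{i\<in>D. i < j}. u (j - i) * (real (j - i) * h) powr p)"
      by (rule sum_distrib_left[symmetric])
    finally have le: "?A j \<le> (u j * (real j * h) powr q)
        * (\<Sum>i\<in>{i\<in>D. i < j}. u (j - i) * (real (j - i) * h) powr p)" .
    have "(\<Sum>i\<in>{i\<in>D. i < j}. u (j - i) * (real (j - i) * h) powr p)
        = (\<Sum>b\<in>(\<lambda>i. j - i) ` {i\<in>D. i < j}. u b * (real b * h) powr p)"
      by (subst sum.reindex) (auto intro!: inj_onI)
    also have "\<dots> \<le> ?G"
      by (rule sum_mono2) (use fin inD moment_term_nonneg in \<open>auto simp: D\<close>)
    finally have "(u j * (real j * h) powr q)
          * (\<Sum>i\<in>{i\<in>D. i < j}. u (j - i) * (real (j - i) * h) powr p)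
        \<le> (u j * (real j * h) powr q) * ?G"
      by (rule mult_left_mono[OF _ moment_term_nonneg]) (use j in auto)
    with le show "?A j \<le> (u j * (real j * h) powr q) * ?G" by linarith
  qed
  also have "\<dots> = (\<Sum>j\<in>{1..N} - D. u j * (real j * h) powr q) * ?G"
    by (rule sum_distrib_right[symmetric])
  also have "\<dots> \<le> moment h q u * ?G"
    by (intro mult_right_mono sum_le_moment q_le G) auto
  finally show ?thesis using split loss by linarith
qed

text \<open>For fixed \<open>j > N\<close> the indices \<open>j - i\<close> with
  \<open>i \<in> D\<close> are distinct and positive, so summing over \<open>i\<close> gives at most
  the moment of order \<open>p\<close>; the sum over \<open>j\<close> is then a tail of the moment
  of order \<open>q\<close>.\<close>

lemma fragment_tail_le:
  assumes D: "D \<subseteq> {1..N}"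
  shows "(\<Sum>i\<in>D. \<Sum>\<^sub>\<infinity>j\<in>{N + 1..}. k i (j - i) * u j * u (j - i))
    \<le> moment h p u * (\<Sum>\<^sub>\<infinity>j\<in>{N + 1..}. u j * (real j * h) powr q)"
proof -
  have fin: "finite D" using D finite_subset by blast
  have "((\<lambda>j. \<Sum>i\<in>D. k i (j - i) * u j * u (j - i)) has_sum
      (\<Sum>i\<in>D. \<Sum>\<^sub>\<infinity>j\<in>{N + 1..}. k i (j - i) * u j * u (j - i))) {N + 1..}"
  proof (rule has_sum_sum[OF fin], rule has_sum_infsum)
    fix i assume "i \<in> D"
    then have "1 \<le> i" "i \<le> N" using D by auto
    then show "(\<lambda>j. k i (j - i) * u j * u (j - i)) summable_on {N + 1..}"
      by (intro summable_on_subset_banach[OF summable_fragment]) auto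
  qed
  moreover have "((\<lambda>j. moment h p u * (u j * (real j * h) powr q)) has_sum
      moment h p u * (\<Sum>\<^sub>\<infinity>j\<in>{N + 1..}. u j * (real j * h) powr q)) {N + 1..}"
    by (intro has_sum_cmult_right has_sum_infsum
        summable_on_subset_banach[OF summable_moment[OF q_le]]) auto
  ultimately show ?thesis
  proof (rule has_sum_mono)
    fix j assume j: "j \<in> {N + 1..}"
    have "(\<Sum>i\<in>D. k i (j - i) * u j * u (j - i))
        \<le> (\<Sum>i\<in>D. (u j * (real j * h) powr q) * (u (j - i) * (real (j - i) * h) powr p))"
      by (rule sum_mono, rule fragment_term_le) (use D j in auto)
    also have "\<dots> = (u j * (real j * h) powr q) * (\<Sum>i\<in>D. u (j - i) * (real (j - i) * h) powr p)"
      by (rule sum_distrib_left[symmetric])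
    finally have le: "(\<Sum>i\<in>D. k i (j - i) * u j * u (j - i))
        \<le> (u j * (real j * h) powr q) * (\<Sum>i\<in>D. u (j - i) * (real (j - i) * h) powr p)" .
    have "(\<Sum>i\<in>D. u (j - i) * (real (j - i) * h) powr p)
        = (\<Sum>b\<in>(\<lambda>i. j - i) ` D. u b * (real b * h) powr p)"
      by (subst sum.reindex) (use D j in \<open>auto intro!: inj_onI\<close>, fastforce)
    also have "\<dots> \<le> moment h p u"
      by (rule sum_le_moment[OF p_le]) (use D j fin in fastforce)+
    finally have "(u j * (real j * h) powr q) * (\<Sum>i\<in>D. u (j - i) * (real (j - i) * h) powr p)
        \<le> (u j * (real j * h) powr q) * moment h p u"
      by (rule mult_left_mono[OF _ moment_term_nonneg]) (use j in auto)
    with le show "(\<Sum>i\<in>D. k i (j - i) * u j * u (j - i))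
        \<le> moment h p u * (u j * (real j * h) powr q)"
      by (simp only: mult.commute[of "moment h p u"])
  qed
qed

text \<open>The loss cancels part of the gains with \<open>j \<le> N\<close>. Of the factor 2, one
  copy comes from the rest of these gains and one from the term carrying \<open>u i * u j\<close>;
  the last summand bounds the gains with \<open>j > N\<close>.\<close>

lemma S23_sum_le:
  assumes D: "D = {i\<in>{1..N}. \<not> d dvd i}"
  shows "(\<Sum>i\<in>D. S23 h \<alpha> \<beta> n u i)
    \<le> 2 * moment h q u * (\<Sum>i\<in>D. u i * (real i * h) powr p)
      + moment h p u * ((real (N + 1) * h) powr (q - \<kappa>) * moment h \<kappa> u)"
proof -
  let ?frag = "\<lambda>i j. k i (j - i) * u j * u (j - i)"
  have "(\<Sum>i\<in>D. \<Sum>\<^sub>\<infinity>j\<in>{i + 1..}. ?frag i j)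
      = (\<Sum>i\<in>D. (\<Sum>j\<in>{i + 1..N}. ?frag i j) + (\<Sum>\<^sub>\<infinity>j\<in>{N + 1..}. ?frag i j))"
    by (intro sum.cong refl infsum_split_at summable_fragment) (auto simp: D)
  also have "\<dots> = (\<Sum>i\<in>D. \<Sum>j\<in>{i + 1..N}. ?frag i j) + (\<Sum>i\<in>D. \<Sum>\<^sub>\<infinity>j\<in>{N + 1..}. ?frag i j)"
    by (rule sum.distrib)
  finally have split: "(\<Sum>i\<in>D. \<Sum>\<^sub>\<infinity>j\<in>{i + 1..}. ?frag i j)
      = (\<Sum>i\<in>D. \<Sum>j\<in>{i + 1..N}. ?frag i j) + (\<Sum>i\<in>D. \<Sum>\<^sub>\<infinity>j\<in>{N + 1..}. ?frag i j)" .
  have "(\<Sum>i\<in>D. \<Sum>\<^sub>\<infinity>j\<in>{N + 1..}. ?frag i j)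
      \<le> moment h p u * (\<Sum>\<^sub>\<infinity>j\<in>{N + 1..}. u j * (real j * h) powr q)"
    by (rule fragment_tail_le) (auto simp: D)
  also have "\<dots> \<le> moment h p u * ((real (N + 1) * h) powr (q - \<kappa>) * moment h \<kappa> u)"
    by (rule mult_left_mono[OF moment_tail_le[OF q_le] moment_nonneg]) simp
  finally have "(\<Sum>i\<in>D. \<Sum>\<^sub>\<infinity>j\<in>{i + 1..}. ?frag i j)
      \<le> (\<Sum>i\<in>D. \<Sum>j\<in>{1..<i}. k (i - j) j * u i * u j)
        + moment h q u * (\<Sum>i\<in>D. u i * (real i * h) powr p)
        + moment h p u * ((real (N + 1) * h) powr (q - \<kappa>) * moment h \<kappa> u)"
    using split fragment_sum_le[OF D] by linarith
  moreover have "(\<Sum>i\<in>D. \<Sum>\<^sub>\<infinity>j\<in>{i + 1..}. k (j - i) i * u i * u j)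
      \<le> (\<Sum>i\<in>D. (u i * (real i * h) powr p) * moment h q u)"
    by (rule sum_mono, rule infsum_transfer_le) (simp add: D)
  moreover have "\<dots> = moment h q u * (\<Sum>i\<in>D. u i * (real i * h) powr p)"
    by (simp add: sum_distrib_left mult.commute)
  ultimately show ?thesis
    unfolding S23_def sum.distrib sum_negf by linarith
qed

section \<open>Lower bounds by gain minus linear loss\<close>

lemma S1_ge:
  assumes n: "n = 1" and i: "1 \<le> i"
  shows "S1 h \<alpha> \<beta> u i \<ge> (\<Sum>j\<in>{1..<i}. k j (i - j) * u j * u (i - j))
    - 2 * (real (i + 1) powr q * (real i * h) powr p) * moment h q u * u i"
proof -
  have "(\<Sum>\<^sub>\<infinity>j\<in>{1..}. k i j * u i * u j) = u i * (\<Sum>\<^sub>\<infinity>j\<in>{1..}. k i j * u j)"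
    by (subst infsum_cmult_right'[symmetric]) (simp only: mult_ac)
  also have "\<dots> \<le> u i * ((real (i + 1) powr q * (real i * h) powr p) * moment h q u)"
    by (rule mult_left_mono[OF infsum_collision_le[OF i] u_nonneg[OF i]])
  finally show ?thesis unfolding S1_def using n by (simp add: mult_ac)
qed

text \<open>The finite sum is the only negative part and is linear in \<open>u i\<close>. The
  nonnegative term carrying \<open>u i * u j\<close> is dropped, as it gives nothing where
  \<open>u i = 0\<close>.\<close>

lemma S23_ge:
  assumes i: "1 \<le> i"
  shows "S23 h \<alpha> \<beta> n u i \<ge> (\<Sum>\<^sub>\<infinity>j\<in>{i + 1..}. k i (j - i) * u j * u (j - i))
    - (real i * h) powr q * moment h p u * u i"
proof -
  have "(\<Sum>j\<in>{1..<i}. k (i - j) j * u i * u j) = (\<Sum>j\<in>{1..<i}. k (i - j) j * u j) * u i"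
    unfolding sum_distrib_right by (simp only: mult_ac)
  also have "\<dots> \<le> (real i * h) powr q * moment h p u * u i"
    by (rule mult_right_mono[OF sum_loss_le u_nonneg[OF i]])
  finally have "(\<Sum>j\<in>{1..<i}. k (i - j) j * u i * u j) \<le> (real i * h) powr q * moment h p u * u i" .
  moreover have "(\<Sum>\<^sub>\<infinity>j\<in>{i + 1..}. k (j - i) i * u i * u j) \<ge> 0"
    by (rule infsum_nonneg) (use i K_nonneg u_nonneg in auto)
  ultimately show ?thesis unfolding S23_def by linarith
qed

lemma kernel_pos: "1 \<le> i \<Longrightarrow> 1 \<le> j \<Longrightarrow> k i j > 0"
  unfolding K_def using h_pos
  by (simp add: distrib_right[symmetric] of_nat_add[symmetric] del: of_nat_add)

lemma S1_gain_nonneg: "(\<Sum>j\<in>{1..<i}. k j (i - j) * u j * u (i - j)) \<ge> 0"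
  by (intro sum_nonneg) (auto simp: K_nonneg u_nonneg)

lemma S23_gain_nonneg: "1 \<le> i \<Longrightarrow> (\<Sum>\<^sub>\<infinity>j\<in>{i + 1..}. k i (j - i) * u j * u (j - i)) \<ge> 0"
  by (rule infsum_nonneg) (use fragment_term_nonneg in auto)

lemma S1_gain_pos:
  assumes "1 \<le> a" "1 \<le> b" "u a > 0" "u b > 0"
  shows "(\<Sum>j\<in>{1..<a + b}. k j (a + b - j) * u j * u (a + b - j)) > 0"
  by (rule sum_pos2[where i = a]) (use assms kernel_pos u_nonneg K_nonneg in auto)

lemma S23_gain_pos:
  assumes i: "1 \<le> i" and b: "1 \<le> b" and pos: "u (i + b) > 0" "u b > 0"
  shows "(\<Sum>\<^sub>\<infinity>j\<in>{i + 1..}. k i (j - i) * u j * u (j - i)) > 0"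
proof -
  have "0 < k i b * u (i + b) * u b"
    using pos kernel_pos[OF i b] by simp
  also have "\<dots> = (\<Sum>j\<in>{i + b}. k i (j - i) * u j * u (j - i))"
    by simp
  also have "\<dots> \<le> (\<Sum>\<^sub>\<infinity>j\<in>{i + 1..}. k i (j - i) * u j * u (j - i))"
  proof (rule finite_sum_le_infsum[OF summable_fragment[OF i]])
    show "0 \<le> k i (j - i) * u j * u (j - i)" if "j \<in> {i + 1..} - {i + b}" for j
      using fragment_term_nonneg[OF i, of j] that by simp
  qed (use b in auto)
  finally show ?thesis .
qed

end

section \<open>Evolution in time\<close>

text \<open>At interior points the derivative within the half-line is the ordinary one; the endpoint
  0 enters only through continuity.\<close>

lemma antimono_from_derivative:
  fixes g g' :: "real \<Rightarrow> real"
  assumes der: "\<And>t. t \<ge> 0 \<Longrightarrow> (g has_real_derivative g' t) (at t within {0..})"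
    and le: "\<And>t. t \<ge> 0 \<Longrightarrow> g' t \<le> 0"
    and st: "0 \<le> s" "s \<le> t"
  shows "g t \<le> g s"
proof (rule DERIV_nonpos_imp_decreasing_open[OF st(2)])
  fix x assume x: "s < x" "x < t"
  then have "at x within {0..} = at x"
    using st by (intro at_within_interior) auto
  then show "\<exists>y. DERIV g x :> y \<and> y \<le> 0"
    using der[of x] le[of x] x st by auto
next
  have "continuous_on {0..} g"
    using der by (auto intro!: DERIV_continuous_on)
  then show "continuous_on {s..t} g"
    by (rule continuous_on_subset) (use st in auto)
qed

text \<open>The integrating factor \<open>exp (- C * t)\<close> is at most 1, so the error
  contributes at most \<open>\<epsilon>\<close> per unit of time.\<close>

lemma gronwall_linear:
  fixes g g' :: "real \<Rightarrow> real"
  assumes der: "\<And>t. t \<ge> 0 \<Longrightarrow> (g has_real_derivative g' t) (at t within {0..})"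
    and le: "\<And>t. t \<ge> 0 \<Longrightarrow> g' t \<le> C * g t + \<epsilon>"
    and C: "C \<ge> 0" and \<epsilon>: "\<epsilon> \<ge> 0" and st: "0 \<le> s" "s \<le> t"
  shows "g t * exp (- C * t) \<le> g s * exp (- C * s) + \<epsilon> * (t - s)"
proof -
  have "g t * exp (- C * t) - \<epsilon> * t \<le> g s * exp (- C * s) - \<epsilon> * s"
  proof (rule antimono_from_derivative[OF _ _ st])
    fix t :: real assume t: "t \<ge> 0"
    show "((\<lambda>t. g t * exp (- C * t) - \<epsilon> * t) has_real_derivative
        (g' t - C * g t) * exp (- C * t) - \<epsilon>) (at t within {0..})"
      by (rule derivative_eq_intros der t refl | simp)+ (simp add: algebra_simps)
    have "(g' t - C * g t) * exp (- C * t) \<le> \<epsilon> * exp (- C * t)"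
      using le[OF t] by (intro mult_right_mono) auto
    also have "\<dots> \<le> \<epsilon> * 1"
      using C t by (intro mult_left_mono \<epsilon>) auto
    finally show "(g' t - C * g t) * exp (- C * t) - \<epsilon> \<le> 0" by simp
  qed
  then show ?thesis by (simp add: algebra_simps)
qed

section \<open>Solutions seen through their components\<close>

text \<open>The equation is required index by index, and the single time-independent bound
  \<open>B\<close> makes all later constants uniform in time.\<close>

locale wave_solution =
  fixes h \<delta> \<kappa> B :: real and \<alpha> \<beta> :: "nat \<Rightarrow> real" and f :: "real \<Rightarrow> nat \<Rightarrow> real"
  assumes h_pos: "h > 0"
    and exponents: "n \<in> {1, 2, 3} \<Longrightarrow> \<alpha> n > 0"
      "n \<in> {1, 2, 3} \<Longrightarrow> \<beta> n > 0"
      "n \<in> {1, 2, 3} \<Longrightarrow> \<alpha> n + \<beta> n < \<delta>"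
    and \<delta>_less: "\<delta> < \<kappa>"
    and nonneg: "t \<ge> 0 \<Longrightarrow> i \<ge> 1 \<Longrightarrow> f t i \<ge> 0"
    and finite_moment: "t \<ge> 0 \<Longrightarrow> finite_moment h \<kappa> (f t)"
    and moment_bound: "t \<ge> 0 \<Longrightarrow> moment h \<kappa> (f t) \<le> B"
    and derivative: "t \<ge> 0 \<Longrightarrow> i \<ge> 1 \<Longrightarrow>
      ((\<lambda>t. f t i) has_real_derivative wave_op h \<alpha> \<beta> \<delta> (f t) i) (at t within {0..})"
begin

text \<open>A bound, uniform in time, for the moment of order \<open>p \<le> \<kappa>\<close>; the
  factor reflects that \<open>h\<close> is the smallest grid point.\<close>

abbreviation "M p \<equiv> h powr (p - \<kappa>) * B"

lemma kernel_sequence: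
  assumes "t \<ge> 0" "n \<in> {1, 2, 3}"
  shows "kernel_sequence h \<kappa> (f t) \<alpha> \<beta> n"
proof
  show "h > 0" by (rule h_pos)
  show "f t i \<ge> 0" if "i \<ge> 1" for i by (rule nonneg[OF assms(1) that])
  show "finite_moment h \<kappa> (f t)" by (rule finite_moment[OF assms(1)])
  show "\<alpha> n > 0" "\<beta> n > 0" by (rule exponents[OF assms(2)])+
  show "\<alpha> n + \<beta> n < \<kappa>" using exponents(3)[OF assms(2)] \<delta>_less by linarith
qed

lemma moment_sequence: "t \<ge> 0 \<Longrightarrow> moment_sequence h \<kappa> (f t)"
  using kernel_sequence[of t 1] by (simp add: kernel_sequence_def)

lemma moment_le:
  assumes "t \<ge> 0" "p \<le> \<kappa>"
  shows "moment h p (f t) \<le> M p"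
  using moment_sequence.moment_le[OF moment_sequence assms(2), of t]
    mult_left_mono[OF moment_bound, of t "h powr (p - \<kappa>)"] assms by simp

lemma moment_nonneg: "t \<ge> 0 \<Longrightarrow> moment h p (f t) \<ge> 0"
  by (rule moment_sequence.moment_nonneg[OF moment_sequence])

lemma B_nonneg: "B \<ge> 0"
  using moment_nonneg[of 0 \<kappa>] moment_bound[of 0] by simp

lemma exponents_le: "n \<in> {1, 2, 3} \<Longrightarrow> \<alpha> n \<le> \<kappa>" "n \<in> {1, 2, 3} \<Longrightarrow> \<alpha> n + \<beta> n \<le> \<kappa>"
  using exponents[of n] \<delta>_less by auto

text \<open>The total coefficient of the losses of \<open>i\<close>, each moment replaced by its
  bound \<open>M\<close>: coagulation, the two other interactions, damping.\<close>

definition loss_rate :: "nat \<Rightarrow> real" where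
  "loss_rate i = 2 * (real (i + 1) powr (\<alpha> 1 + \<beta> 1) * (real i * h) powr \<alpha> 1) * M (\<alpha> 1 + \<beta> 1)
    + (real i * h) powr (\<alpha> 2 + \<beta> 2) * M (\<alpha> 2)
    + (real i * h) powr (\<alpha> 3 + \<beta> 3) * M (\<alpha> 3) + (real i * h) powr \<delta>"

lemma wave_op_ge:
  assumes t: "t \<ge> 0" and i: "i \<ge> 1"
  shows "wave_op h \<alpha> \<beta> \<delta> (f t) i \<ge>
    (\<Sum>j\<in>{1..<i}. K \<alpha> \<beta> 1 (real j * h) (real (i - j) * h) * f t j * f t (i - j))
    + (\<Sum>\<^sub>\<infinity>j\<in>{i + 1..}. K \<alpha> \<beta> 2 (real i * h) (real (j - i) * h) * f t j * f t (j - i))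
    + (\<Sum>\<^sub>\<infinity>j\<in>{i + 1..}. K \<alpha> \<beta> 3 (real i * h) (real (j - i) * h) * f t j * f t (j - i))
    - loss_rate i * f t i"
proof -
  note [simp] = nonneg[OF t i]
  have loss: "c * moment h p (f t) * f t i \<le> c * M p * f t i" if "c \<ge> 0" "p \<le> \<kappa>" for c p
    using that moment_le[OF t] by (intro mult_right_mono mult_left_mono) auto
  have "2 * (real (i + 1) powr (\<alpha> 1 + \<beta> 1) * (real i * h) powr \<alpha> 1) * moment h (\<alpha> 1 + \<beta> 1) (f t) * f t i
      \<le> 2 * (real (i + 1) powr (\<alpha> 1 + \<beta> 1) * (real i * h) powr \<alpha> 1) * M (\<alpha> 1 + \<beta> 1) * f t i"
    "(real i * h) powr (\<alpha> 2 + \<beta> 2) * moment h (\<alpha> 2) (f t) * f t i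
      \<le> (real i * h) powr (\<alpha> 2 + \<beta> 2) * M (\<alpha> 2) * f t i"
    "(real i * h) powr (\<alpha> 3 + \<beta> 3) * moment h (\<alpha> 3) (f t) * f t i
      \<le> (real i * h) powr (\<alpha> 3 + \<beta> 3) * M (\<alpha> 3) * f t i"
    by (rule loss; simp add: exponents_le)+
  moreover have "1 \<in> {1, 2, 3::nat}" "2 \<in> {1, 2, 3::nat}" "3 \<in> {1, 2, 3::nat}" by auto
  note n = this
  ultimately show ?thesis
    using kernel_sequence.S1_ge[OF kernel_sequence[OF t n(1)] refl i]
      kernel_sequence.S23_ge[OF kernel_sequence[OF t n(2)] i]
      kernel_sequence.S23_ge[OF kernel_sequence[OF t n(3)] i]
    unfolding wave_op_def V_def loss_rate_def distrib_right[of _ _ "f t i"] by linarith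
qed

section \<open>Propagation of positivity\<close>

text \<open>All gains are nonnegative, so \<open>f t i * exp (L * t)\<close> is nondecreasing in
  time.\<close>

lemma positivity_persists:
  assumes i: "i \<ge> 1" and s: "0 \<le> s" "s \<le> t" and pos: "f s i > 0"
  shows "f t i > 0"
proof -
  define L where "L = loss_rate i"
  have "- (f t i * exp (L * t)) \<le> - (f s i * exp (L * s))"
  proof (rule antimono_from_derivative[OF _ _ s])
    fix t :: real assume t: "t \<ge> 0"
    let ?w = "wave_op h \<alpha> \<beta> \<delta> (f t) i"
    show "((\<lambda>t. - (f t i * exp (L * t))) has_real_derivative
        - ((?w + L * f t i) * exp (L * t))) (at t within {0..})"
      by (rule derivative_eq_intros derivative t i refl | simp)+ (simp add: algebra_simps)
    have "?w \<ge> - L * f t i"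
      using wave_op_ge[OF t i]
        kernel_sequence.S1_gain_nonneg[OF kernel_sequence[OF t, of 1], of i]
        kernel_sequence.S23_gain_nonneg[OF kernel_sequence[OF t, of 2] i]
        kernel_sequence.S23_gain_nonneg[OF kernel_sequence[OF t, of 3] i]
      unfolding L_def by simp
    then show "- ((?w + L * f t i) * exp (L * t)) \<le> 0" by simp
  qed
  moreover have "f s i * exp (L * s) > 0" using pos by simp
  ultimately have "f t i * exp (L * t) > 0" by linarith
  then show ?thesis by (simp add: zero_less_mult_iff)
qed

text \<open>A zero at a positive time is an interior minimum of a nonnegative function, where the
  derivative has to vanish.\<close>

lemma positive_if_gain:
  assumes i: "i \<ge> 1" and t: "t > 0"
    and gain: "f t i = 0 \<Longrightarrow> wave_op h \<alpha> \<beta> \<delta> (f t) i > 0"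
  shows "f t i > 0"
proof (rule ccontr)
  assume "\<not> ?thesis"
  then have zero: "f t i = 0" using nonneg[of t i] t i by simp
  have "at t within {0..} = at t" using t by (intro at_within_interior) auto
  then have "DERIV (\<lambda>t. f t i) t :> wave_op h \<alpha> \<beta> \<delta> (f t) i"
    using derivative[of t i] t i by simp
  then have "wave_op h \<alpha> \<beta> \<delta> (f t) i = 0"
    \<comment> \<open>The radius of the neighbourhood is \<open>t\<close> itself, so all comparison
      times are positive.\<close>
    by (rule DERIV_local_min[OF _ t]) (use zero nonneg i in auto)
  then show False using gain zero by simp
qed

lemma positive_add:
  assumes "a \<ge> 1" "b \<ge> 1" "t > 0" "f t a > 0" "f t b > 0"
  shows "f t (a + b) > 0"
proof (rule positive_if_gain)
  have t: "t \<ge> 0" and i: "a + b \<ge> 1" using assms by auto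
  assume "f t (a + b) = 0"
  then show "wave_op h \<alpha> \<beta> \<delta> (f t) (a + b) > 0"
    using wave_op_ge[OF t i]
      kernel_sequence.S1_gain_pos[OF kernel_sequence[OF t, of 1] assms(1,2,4,5)]
      kernel_sequence.S23_gain_nonneg[OF kernel_sequence[OF t, of 2] i]
      kernel_sequence.S23_gain_nonneg[OF kernel_sequence[OF t, of 3] i]
    by simp
qed (use assms in auto)

text \<open>The term \<open>j = i + b\<close> of the gain with \<open>n = 2\<close> contains
  \<open>f t (i + b) * f t b\<close>; the other gains contribute nonnegatively.\<close>

lemma positive_diff:
  assumes "i \<ge> 1" "b \<ge> 1" "t > 0" "f t (i + b) > 0" "f t b > 0"
  shows "f t i > 0"
proof (rule positive_if_gain)
  have t: "t \<ge> 0" using assms by auto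
  assume "f t i = 0"
  then show "wave_op h \<alpha> \<beta> \<delta> (f t) i > 0"
    using wave_op_ge[OF t assms(1)]
      kernel_sequence.S1_gain_nonneg[OF kernel_sequence[OF t, of 1], of i]
      kernel_sequence.S23_gain_pos[OF kernel_sequence[OF t, of 2] assms(1,2,4,5)]
      kernel_sequence.S23_gain_nonneg[OF kernel_sequence[OF t, of 3] assms(1)]
    by simp
qed (use assms in auto)

text \<open>Persistence carries the initial support to time \<open>t\<close>, and the gains at that
  same time close the positivity set under sums and differences.\<close>

lemma positive_on_multiples:
  assumes "t > 0" "i \<ge> 1" "Gcd {i. i \<ge> 1 \<and> f 0 i > 0} dvd i"
  shows "f t i > 0"
proof -
  have "i \<in> {i. i \<ge> 1 \<and> f t i > 0}"
  proof (rule additive_subtractive_contains_multiples[OF _ _ _ _ assms(3,2)])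
    show "a - b \<in> {i. i \<ge> 1 \<and> f t i > 0}"
      if "a \<in> {i. i \<ge> 1 \<and> f t i > 0}" "b \<in> {i. i \<ge> 1 \<and> f t i > 0}" "b < a" for a b
      using positive_diff[of "a - b" b t] that assms(1) by auto
  qed (use positive_add positivity_persists[of _ 0 t] assms(1) in auto)
  then show ?thesis by simp
qed

section \<open>Vanishing outside the multiples\<close>

text \<open>The truncation error of \<open>S23_sum_le\<close> with its moments replaced by bounds
  uniform in time; the exponent of \<open>N + 1\<close> is negative.\<close>

definition tail :: "nat \<Rightarrow> nat \<Rightarrow> real" where
  "tail n N = M (\<alpha> n) * ((real (N + 1) * h) powr (\<alpha> n + \<beta> n - \<kappa>) * B)"

lemma tail_nonneg: "tail n N \<ge> 0"
  unfolding tail_def using B_nonneg by simp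

lemma tail_tendsto:
  assumes "n \<in> {1, 2, 3}"
  shows "tail n \<longlonglongrightarrow> 0"
proof -
  have "filterlim (\<lambda>N. real (N + 1)) at_top sequentially"
    by (rule filterlim_compose[OF filterlim_real_sequentially filterlim_add_const_nat_at_top])
  then have "filterlim (\<lambda>N. real (N + 1) * h) at_top sequentially"
    by (rule filterlim_at_top_mult_tendsto_pos[OF tendsto_const h_pos])
  then have "(\<lambda>N. (real (N + 1) * h) powr (\<alpha> n + \<beta> n - \<kappa>)) \<longlonglongrightarrow> 0"
    using exponents[OF assms] \<delta>_less by (intro tendsto_neg_powr) auto
  then have "(\<lambda>N. M (\<alpha> n) * ((real (N + 1) * h) powr (\<alpha> n + \<beta> n - \<kappa>) * B)) \<longlonglongrightarrow> M (\<alpha> n) * (0 * B)"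
    by (intro tendsto_intros)
  then show ?thesis unfolding tail_def[abs_def] by simp
qed

lemma S23_sum_bound:
  assumes t: "t \<ge> 0" and n: "n \<in> {1, 2, 3}" and D: "D = {i\<in>{1..N}. \<not> d dvd i}"
  shows "(\<Sum>i\<in>D. S23 h \<alpha> \<beta> n (f t) i)
    \<le> (\<Sum>i\<in>D. 2 * M (\<alpha> n + \<beta> n) * (real i * h) powr \<alpha> n * f t i) + tail n N"
proof -
  let ?G = "\<Sum>i\<in>D. f t i * (real i * h) powr \<alpha> n"
  have "?G \<ge> 0" using nonneg[OF t] by (intro sum_nonneg) (auto simp: D)
  then have "2 * moment h (\<alpha> n + \<beta> n) (f t) * ?G \<le> 2 * M (\<alpha> n + \<beta> n) * ?G"
    using moment_le[OF t exponents_le(2)[OF n]] by (intro mult_right_mono mult_left_mono) auto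
  moreover have "2 * M (\<alpha> n + \<beta> n) * ?G
      = (\<Sum>i\<in>D. 2 * M (\<alpha> n + \<beta> n) * (real i * h) powr \<alpha> n * f t i)"
    unfolding sum_distrib_left by (intro sum.cong) auto
  moreover have "moment h (\<alpha> n) (f t) * ((real (N + 1) * h) powr (\<alpha> n + \<beta> n - \<kappa>) * moment h \<kappa> (f t))
      \<le> tail n N"
    unfolding tail_def
    using moment_le[OF t exponents_le(1)[OF n]] moment_bound[OF t] moment_nonneg[OF t] B_nonneg
    by (intro mult_mono mult_left_mono) auto
  ultimately show ?thesis
    using kernel_sequence.S23_sum_le[OF kernel_sequence[OF t n] D] by linarith
qed

text \<open>Each of the two growth terms uses one half of the damping, as both exponents lie below
  \<open>\<delta>\<close>. The constant serves all grid points at once.\<close>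

lemma growth_absorbed:
  obtains C where "C \<ge> 0"
    "\<And>x. x \<ge> 0 \<Longrightarrow> 2 * M (\<alpha> 2 + \<beta> 2) * x powr \<alpha> 2 + 2 * M (\<alpha> 3 + \<beta> 3) * x powr \<alpha> 3 - x powr \<delta> \<le> C"
proof -
  have ex: "0 < \<alpha> n \<and> \<alpha> n < \<delta>" if "n \<in> {1, 2, 3}" for n
    using exponents[OF that] by linarith
  have M: "2 * M p \<ge> 0" for p using B_nonneg by simp
  obtain C2 where C2: "C2 \<ge> 0" "\<And>x. x \<ge> 0 \<Longrightarrow> 2 * M (\<alpha> 2 + \<beta> 2) * x powr \<alpha> 2 \<le> x powr \<delta> / 2 + C2"
    using powr_absorb[of "\<alpha> 2" \<delta> "2 * M (\<alpha> 2 + \<beta> 2)"] ex[of 2] M by blast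
  obtain C3 where C3: "C3 \<ge> 0" "\<And>x. x \<ge> 0 \<Longrightarrow> 2 * M (\<alpha> 3 + \<beta> 3) * x powr \<alpha> 3 \<le> x powr \<delta> / 2 + C3"
    using powr_absorb[of "\<alpha> 3" \<delta> "2 * M (\<alpha> 3 + \<beta> 3)"] ex[of 3] M by blast
  show thesis
  proof (rule that)
    show "C2 + C3 \<ge> 0" using C2 C3 by simp
    show "2 * M (\<alpha> 2 + \<beta> 2) * x powr \<alpha> 2 + 2 * M (\<alpha> 3 + \<beta> 3) * x powr \<alpha> 3 - x powr \<delta> \<le> C2 + C3"
      if "x \<ge> 0" for x
      using C2(2)[OF that] C3(2)[OF that] by linarith
  qed
qed

lemma wave_op_sum_le:
  assumes t: "t \<ge> 0" and D: "D = {i\<in>{1..N}. \<not> d dvd i}"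
    and C: "\<And>x. x \<ge> 0 \<Longrightarrow>
      2 * M (\<alpha> 2 + \<beta> 2) * x powr \<alpha> 2 + 2 * M (\<alpha> 3 + \<beta> 3) * x powr \<alpha> 3 - x powr \<delta> \<le> C"
  shows "(\<Sum>i\<in>D. wave_op h \<alpha> \<beta> \<delta> (f t) i) \<le> C * (\<Sum>i\<in>D. f t i) + (tail 2 N + tail 3 N)"
proof -
  let ?m = "\<lambda>n i. 2 * M (\<alpha> n + \<beta> n) * (real i * h) powr \<alpha> n * f t i"
  have "(\<Sum>i\<in>D. wave_op h \<alpha> \<beta> \<delta> (f t) i)
      = (\<Sum>i\<in>D. S1 h \<alpha> \<beta> (f t) i) + (\<Sum>i\<in>D. S23 h \<alpha> \<beta> 2 (f t) i)
        + (\<Sum>i\<in>D. S23 h \<alpha> \<beta> 3 (f t) i) - (\<Sum>i\<in>D. V h \<delta> (f t) i)"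
    unfolding wave_op_def by (simp add: sum.distrib sum_subtractf)
  moreover have "(\<Sum>i\<in>D. S1 h \<alpha> \<beta> (f t) i) \<le> 0"
    by (rule kernel_sequence.S1_sum_le[OF kernel_sequence[OF t] refl D]) simp
  moreover have "(\<Sum>i\<in>D. ?m 2 i) + (\<Sum>i\<in>D. ?m 3 i) - (\<Sum>i\<in>D. V h \<delta> (f t) i) \<le> C * (\<Sum>i\<in>D. f t i)"
    unfolding sum.distrib[symmetric] sum_subtractf[symmetric] sum_distrib_left
  proof (rule sum_mono)
    fix i assume "i \<in> D"
    then have "f t i \<ge> 0" using nonneg[OF t] by (auto simp: D)
    from mult_right_mono[OF C[of "real i * h"] this] h_pos
    show "?m 2 i + ?m 3 i - V h \<delta> (f t) i \<le> C * f t i"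
      unfolding V_def by (simp add: algebra_simps)
  qed
  moreover have "(\<Sum>i\<in>D. S23 h \<alpha> \<beta> 2 (f t) i) \<le> (\<Sum>i\<in>D. ?m 2 i) + tail 2 N"
    "(\<Sum>i\<in>D. S23 h \<alpha> \<beta> 3 (f t) i) \<le> (\<Sum>i\<in>D. ?m 3 i) + tail 3 N"
    by (rule S23_sum_bound[OF t _ D], simp)+
  ultimately show ?thesis by linarith
qed

text \<open>The truncated sum starts at 0, and the rate \<open>C\<close> is the same for every
  \<open>N\<close>. At a fixed time only the tails are left, and they vanish as \<open>N\<close>
  grows.\<close>

lemma zero_on_nonmultiples:
  assumes init: "\<And>i. i \<ge> 1 \<Longrightarrow> \<not> d dvd i \<Longrightarrow> f 0 i = 0"
    and t: "t \<ge> 0" and i: "i \<ge> 1" "\<not> d dvd i"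
  shows "f t i = 0"
proof -
  obtain C where C: "C \<ge> 0" "\<And>x. x \<ge> 0 \<Longrightarrow>
      2 * M (\<alpha> 2 + \<beta> 2) * x powr \<alpha> 2 + 2 * M (\<alpha> 3 + \<beta> 3) * x powr \<alpha> 3 - x powr \<delta> \<le> C"
    using growth_absorbed by blast
  have bound: "f t i * exp (- C * t) \<le> (tail 2 N + tail 3 N) * t" if N: "N \<ge> i" for N
  proof -
    define D where "D = {i\<in>{1..N}. \<not> d dvd i}"
    let ?g = "\<lambda>t. \<Sum>i\<in>D. f t i"
    have "?g t * exp (- C * t) \<le> ?g 0 * exp (- C * 0) + (tail 2 N + tail 3 N) * (t - 0)"
    proof (rule gronwall_linear[OF _ _ C(1) _ order_refl t])
      fix t :: real assume t: "t \<ge> 0"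
      show "(?g has_real_derivative (\<Sum>i\<in>D. wave_op h \<alpha> \<beta> \<delta> (f t) i)) (at t within {0..})"
        using derivative[OF t] by (intro DERIV_sum) (auto simp: D_def)
      show "(\<Sum>i\<in>D. wave_op h \<alpha> \<beta> \<delta> (f t) i) \<le> C * ?g t + (tail 2 N + tail 3 N)"
        by (rule wave_op_sum_le[OF t D_def C(2)])
    qed (use tail_nonneg in simp)
    moreover have "?g 0 = 0" by (rule sum.neutral) (auto simp: D_def init)
    ultimately have "?g t * exp (- C * t) \<le> (tail 2 N + tail 3 N) * t" by simp
    moreover have "f t i \<le> ?g t"
      by (rule member_le_sum) (use i N nonneg[OF t] in \<open>auto simp: D_def\<close>)
    then have "f t i * exp (- C * t) \<le> ?g t * exp (- C * t)" by (rule mult_right_mono) simp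
    ultimately show ?thesis by linarith
  qed
  have "(\<lambda>N. (tail 2 N + tail 3 N) * t) \<longlonglongrightarrow> (0 + 0) * t"
    by (intro tendsto_intros tail_tendsto) auto
  then have "f t i * exp (- C * t) \<le> (0 + 0) * t"
    by (rule LIMSEQ_le_const) (use bound in blast)
  then have "f t i \<le> 0" by (simp add: mult_le_0_iff)
  then show ?thesis using nonneg[OF t i(1)] by simp
qed

end

section \<open>From the sequence space to components\<close>

lemma abs_seq_le_norm: "\<bar>seq x i\<bar> \<le> norm x"
\<comment> \<open>The norm sums from index 1; at index 0 the type normalises the entry to 0.\<close>
proof (cases "i = 0")
  case True
  then show ?thesis using seq[of x] by simp
next
  case False
  have "(\<Sum>j\<in>{i}. \<bar>seq x j\<bar>) \<le> (\<Sum>\<^sub>\<infinity>j\<in>{1..}. \<bar>seq x j\<bar>)"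
    by (rule finite_sum_le_infsum) (use False seq[of x] in auto)
  then show ?thesis by (simp add: norm_ell1.rep_eq)
qed

text \<open>Continuity of evaluation at an index turns the derivative in norm into derivatives of
  the components.\<close>

lemma bounded_linear_seq: "bounded_linear (\<lambda>x. seq x i)"
  by (rule bounded_linear_intro[where K = 1])
    (simp_all add: plus_ell1.rep_eq scaleR_ell1.rep_eq abs_seq_le_norm)

theorem theorem2p8:
  fixes h \<delta> \<kappa> :: real and \<alpha> \<beta> :: "nat \<Rightarrow> real"
    and f0 :: "nat \<Rightarrow> real" and f :: "real \<Rightarrow> ell1" and I :: "nat set"
  assumes "h > 0"
    and "\<forall>n\<in>{1,2,3}. \<alpha> n > 0 \<and> \<beta> n > 0"
    and "\<delta> > 0"
    and "\<delta> > Max ((\<lambda>n. \<alpha> n + \<beta> n) ` {1,2,3})"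
    and "\<delta> > 2 * \<alpha> 1 + \<beta> 1 - 1"
    and "\<kappa> > Max {\<delta>, 1, 2 - \<alpha> 1 - \<beta> 1}"
    and "\<forall>i\<ge>1. f0 i \<ge> 0"
    and "finite_moment h \<kappa> f0"
    and "is_solution h \<alpha> \<beta> \<delta> \<kappa> f0 f"
    and "I = {i. i \<ge> 1 \<and> f0 i > 0}"
  shows "\<forall>t>0. \<forall>i\<ge>1.
    (i \<in> {Gcd I * n | n. n \<ge> 1} \<longrightarrow> seq (f t) i > 0) \<and>
    (i \<notin> {Gcd I * n | n. n \<ge> 1} \<longrightarrow> seq (f t) i = 0)"
proof -
  note sol = assms(9)[unfolded is_solution_def]
  obtain f' where f': "\<forall>t\<ge>0. (f has_vector_derivative f' t) (at t within {0..}) \<and>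
      (\<forall>i\<ge>1. seq (f' t) i = wave_op h \<alpha> \<beta> \<delta> (seq (f t)) i)"
    using conjunct1[OF sol] by (elim exE conjE)
  have init: "seq (f 0) i = f0 i" if "i \<ge> 1" for i
    using sol[THEN conjunct2, THEN conjunct1] that by simp
  note bounds = sol[THEN conjunct2, THEN conjunct2, rule_format]
  interpret wave_solution h \<delta> \<kappa>
    "max (moment h \<kappa> f0) (2 * B_bound \<alpha> \<beta> \<delta> \<kappa> (moment h 1 f0))" \<alpha> \<beta> "\<lambda>t. seq (f t)"
  proof
    show "\<alpha> n > 0" "\<beta> n > 0" "\<alpha> n + \<beta> n < \<delta>" if "n \<in> {1, 2, 3}" for n
      using assms(2,4) that by auto
    show "\<delta> < \<kappa>" using assms(6) by simp
    fix t :: real assume t: "t \<ge> 0"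
    show "finite_moment h \<kappa> (seq (f t))"
      "moment h \<kappa> (seq (f t)) \<le> max (moment h \<kappa> f0) (2 * B_bound \<alpha> \<beta> \<delta> \<kappa> (moment h 1 f0))"
      using bounds[OF t] by simp_all
    fix i :: nat assume i: "i \<ge> 1"
    show "seq (f t) i \<ge> 0"
      using bounds[OF t] i by simp
    have "(f has_vector_derivative f' t) (at t within {0..})"
      and eq: "seq (f' t) i = wave_op h \<alpha> \<beta> \<delta> (seq (f t)) i"
      using f' t i by auto
    from bounded_linear.has_vector_derivative[OF bounded_linear_seq this(1)]
    have "((\<lambda>t. seq (f t) i) has_vector_derivative seq (f' t) i) (at t within {0..})" .
    then show "((\<lambda>t. seq (f t) i) has_real_derivative wave_op h \<alpha> \<beta> \<delta> (seq (f t)) i) (at t within {0..})"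
      by (simp only: has_real_derivative_iff_has_vector_derivative eq)
  qed (rule assms(1))
  have I: "I = {i. i \<ge> 1 \<and> seq (f 0) i > 0}"
    using assms(10) init by auto
  \<comment> \<open>This includes an empty \<open>I\<close>, where \<open>Gcd I = 0\<close> and both
    sides are false for \<open>i \<ge> 1\<close>; the solution then vanishes identically.\<close>
  have multiples: "i \<in> {Gcd I * n | n. n \<ge> 1} \<longleftrightarrow> Gcd I dvd i" if "i \<ge> 1" for i
    using that by (auto elim!: dvdE simp: Suc_le_eq)
  have outside: "seq (f 0) i = 0" if "i \<ge> 1" "\<not> Gcd I dvd i" for i
  proof -
    have "i \<notin> I" using that(2) Gcd_dvd by blast
    then show ?thesis using I nonneg[of 0 i] that(1) by auto
  qed
  show ?thesis
  proof (intro allI impI)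
    fix t :: real and i :: nat
    assume t: "t > 0" and i: "i \<ge> 1"
    show "(i \<in> {Gcd I * n | n. n \<ge> 1} \<longrightarrow> seq (f t) i > 0) \<and>
        (i \<notin> {Gcd I * n | n. n \<ge> 1} \<longrightarrow> seq (f t) i = 0)"
      unfolding multiples[OF i]
      using positive_on_multiples[folded I, OF t i]
        zero_on_nonmultiples[of "Gcd I", OF outside less_imp_le[OF t] i]
      by blast
  qed
qed

end
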